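(* Let $n>1$ and $m,t\ge 1$ be integers, and let $G\le S_n$, $H\le S_m$, $K\le S_t$ be transitive permutation groups. Let $\Delta_1,\Delta_2$ be self-paired orbitals of $G$, let $\mathcal{I}$ be the diagonal orbital of $G$, let $\Delta_4$ be a self-paired orbital of $H$ which is non-diagonal if $\Delta_1$ is diagonal, and let $\Delta_5$ be a self-paired orbital of $K$ which is non-diagonal if $\Delta_2$ is diagonal. Let $\Gamma=\Gamma(\Delta_1,\Delta_2,\mathcal{I},\Delta_4,\Delta_5)$ be the graph of order $n(m+t)$ defined in the context. Assume that $\Gamma$ has odd order and that $\mathcal{O}(\Delta_1)$ and $\mathcal{O}(\Delta_2)$ are non-singular. Then $\Gamma$ is a nut graph if and only if $\mathcal{O}(\Delta_4)$ and $\mathcal{O}(\Delta_5)$ are non-singular, $\mathcal{O}(\Delta_1\cup\Delta_2)$ is connected, and $\Gamma$ satisfies the valence condition $k_1k_2=d_1d_2$ with respect to the decomposition $(V,U)$ of its vertex set.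
   Context: All graphs are finite. A graph (loops possibly allowed) is singular if $0$ is an eigenvalue of its adjacency matrix (a loop at $i$ contributes $1$ to the diagonal entry $(i,i)$), and non-singular otherwise. A nut graph is a simple graph whose adjacency matrix has a one-dimensional null space spanned by a vector with no zero entries. A permutation group $G\le S_n$ is regarded as acting on $\mathbb{Z}_n$. For a transitive $G\le S_n$, its orbitals are the orbits of the component-wise action of $G$ on $\mathbb{Z}_n\times\mathbb{Z}_n$. The diagonal orbital is $\{(i,i): i\in\mathbb{Z}_n\}$, denoted $\mathcal{I}$; all other orbitals are non-diagonal. An orbital $\Delta$ is self-paired if $(x,y)\in\Delta$ implies $(y,x)\in\Delta$. For an orbital $\Delta$, or a union of orbitals, $\mathcal{O}(\Delta)$ is the digraph with vertex set $\mathbb{Z}_n$ and arc set $\Delta$; when the orbitals are self-paired it is regarded as an undirected graph (possibly with loops). The same definitions apply to $H\le S_m$ acting on $\mathbb{Z}_m$ and $K\le S_t$ acting on $\mathbb{Z}_t$. The graph $\Gamma=\Gamma(\Delta_1,\Delta_2,\mathcal{I},\Delta_4,\Delta_5)$ has vertex set $V\cup U$ (disjoint), where $V=\{v_i^j: i\in\mathbb{Z}_n, j\in\mathbb{Z}_m\}$ and $U=\{u_i^j: i\in\mathbb{Z}_n, j\in\mathbb{Z}_t\}$, and edge set $E_1\cup E_2\cup E_3$, where $E_1=\{v_i^jv_{i'}^{j'}: (i,i')\in\Delta_1,\ (j,j')\in\Delta_4\}$, $E_2=\{u_i^ju_{i'}^{j'}: (i,i')\in\Delta_2,\ (j,j')\in\Delta_5\}$,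 $E_3=\{v_i^ju_{i'}^{j'}: (i,i')\in\mathcal{I},\ j\in\mathbb{Z}_m,\ j'\in\mathbb{Z}_t\}$. Here $k_1$ is the valence of the regular induced subgraph $\Gamma[V]$, $k_2$ is the valence of the regular induced subgraph $\Gamma[U]$, $d_1$ is the number of neighbors in $U$ of each vertex of $V$, and $d_2$ is the number of neighbors in $V$ of each vertex of $U$ (these numbers are well defined). *)

theory Defs
  imports
    "HOL-Algebra.Group_Action"
    "Graph_Theory.Graph_Theory"
    "Jordan_Normal_Form.Char_Poly"
    "Jordan_Normal_Form.Matrix_Kernel"
begin

section \<open>Adjacency matrices, singular graphs and nut graphs\<close>

text \<open>
  Graphs are digraphs without parallel arcs; an undirected graph has both arcs of each edge.
  Matrices are indexed by natural numbers, so the adjacency matrix is taken with respect to an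
  arbitrarily chosen enumeration of the vertices. Changing the enumeration permutes rows and
  columns simultaneously, which affects none of the notions below.
\<close>

definition vertex_enum :: "'v pair_pre_digraph \<Rightarrow> 'v list" where
  "vertex_enum G = (SOME vs. distinct vs \<and> set vs = pverts G)"

lemma vertex_enum:
  assumes "finite (pverts G)"
  shows "distinct (vertex_enum G)" and "set (vertex_enum G) = pverts G"
proof -
  have "\<exists>vs. distinct vs \<and> set vs = pverts G"
    using finite_distinct_list[OF assms] by blast
  then have "distinct (vertex_enum G) \<and> set (vertex_enum G) = pverts G"
    unfolding vertex_enum_def by (rule someI_ex)
  then show "distinct (vertex_enum G)" and "set (vertex_enum G) = pverts G"
    by auto
qed

definition adj_matrix :: "'v pair_pre_digraph \<Rightarrow> real mat" where
  "adj_matrix G =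
     mat (card (pverts G)) (card (pverts G))
       (\<lambda>(i, j). if (vertex_enum G ! i, vertex_enum G ! j) \<in> parcs G then 1 else 0)"

definition singular_graph :: "'v pair_pre_digraph \<Rightarrow> bool" where
  "singular_graph G \<longleftrightarrow> eigenvalue (adj_matrix G) 0"

definition nut_graph :: "'v pair_pre_digraph \<Rightarrow> bool" where
  "nut_graph G \<longleftrightarrow>
     pair_graph G \<and>
     kernel_dim (adj_matrix G) = 1 \<and>
     (\<exists>x \<in> mat_kernel (adj_matrix G).
        kernel.span (dim_col (adj_matrix G)) (adj_matrix G) {x} = mat_kernel (adj_matrix G) \<and>
        (\<forall>i < dim_vec x. x $ i \<noteq> 0))"


section \<open>Transitive permutation groups and orbitals\<close>

text \<open>The set \<open>{..<n}\<close> plays the role of the integers modulo \<open>n\<close>, on which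
  the symmetric group \<open>BijGroup {..<n}\<close> acts.\<close>

abbreviation perm_group :: "nat \<Rightarrow> (nat \<Rightarrow> nat) set \<Rightarrow> (nat \<Rightarrow> nat) monoid" where
  "perm_group n G \<equiv> (BijGroup {..<n})\<lparr>carrier := G\<rparr>"

definition transitive_perm_group :: "nat \<Rightarrow> (nat \<Rightarrow> nat) set \<Rightarrow> bool" where
  "transitive_perm_group n G \<longleftrightarrow>
     subgroup G (BijGroup {..<n}) \<and> transitive_action (perm_group n G) {..<n} (\<lambda>g. g)"

definition orbitals :: "nat \<Rightarrow> (nat \<Rightarrow> nat) set \<Rightarrow> nat rel set" where
  "orbitals n G = Group_Action.orbits (perm_group n G) ({..<n} \<times> {..<n}) (\<lambda>g. map_prod g g)"

definition diagonal_orbital :: "nat \<Rightarrow> nat rel" where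
  "diagonal_orbital n = {(i, i) | i. i < n}"

definition self_paired :: "nat rel \<Rightarrow> bool" where
  "self_paired \<Delta> \<longleftrightarrow> (\<forall>x y. (x, y) \<in> \<Delta> \<longrightarrow> (y, x) \<in> \<Delta>)"

definition orbital_graph :: "nat \<Rightarrow> nat rel \<Rightarrow> nat pair_pre_digraph" where
  "orbital_graph n \<Delta> = \<lparr>pverts = {..<n}, parcs = \<Delta>\<rparr>"


section \<open>The graph \<open>\<Gamma>\<close> and the valence condition\<close>

text \<open>\<open>Inl (i, j)\<close> is the vertex $v_i^j$ and \<open>Inr (i, j)\<close> is the vertex $u_i^j$.\<close>

type_synonym gvertex = "nat \<times> nat + nat \<times> nat"

definition V_part :: "nat \<Rightarrow> nat \<Rightarrow> gvertex set" where
  "V_part n m = {Inl (i, j) | i j. i < n \<and> j < m}"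

definition U_part :: "nat \<Rightarrow> nat \<Rightarrow> gvertex set" where
  "U_part n t = {Inr (i, j) | i j. i < n \<and> j < t}"

definition edges1 :: "nat rel \<Rightarrow> nat rel \<Rightarrow> gvertex rel" where
  "edges1 \<Delta>1 \<Delta>4 = {(Inl (i, j), Inl (i', j')) | i j i' j'. (i, i') \<in> \<Delta>1 \<and> (j, j') \<in> \<Delta>4}"

definition edges2 :: "nat rel \<Rightarrow> nat rel \<Rightarrow> gvertex rel" where
  "edges2 \<Delta>2 \<Delta>5 = {(Inr (i, j), Inr (i', j')) | i j i' j'. (i, i') \<in> \<Delta>2 \<and> (j, j') \<in> \<Delta>5}"

definition edges3 :: "nat \<Rightarrow> nat \<Rightarrow> nat rel \<Rightarrow> gvertex rel" where
  "edges3 m t \<Delta>3 = {(Inl (i, j), Inr (i', j')) | i j i' j'. (i, i') \<in> \<Delta>3 \<and> j < m \<and> j' < t}"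

text \<open>The edges are unordered pairs, hence the symmetric closure.\<close>

definition Gamma_graph ::
    "nat \<Rightarrow> nat \<Rightarrow> nat \<Rightarrow> nat rel \<Rightarrow> nat rel \<Rightarrow> nat rel \<Rightarrow> nat rel \<Rightarrow> nat rel
      \<Rightarrow> gvertex pair_pre_digraph" where
  "Gamma_graph n m t \<Delta>1 \<Delta>2 \<Delta>3 \<Delta>4 \<Delta>5 =
     (let E = edges1 \<Delta>1 \<Delta>4 \<union> edges2 \<Delta>2 \<Delta>5 \<union> edges3 m t \<Delta>3
      in \<lparr>pverts = V_part n m \<union> U_part n t, parcs = E \<union> E\<inverse>\<rparr>)"

definition regular_of_valence :: "('v, 'e) pre_digraph \<Rightarrow> nat \<Rightarrow> bool" where
  "regular_of_valence G k \<longleftrightarrow> (\<forall>v \<in> verts G. out_degree G v = k)"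

definition neighbors_in :: "'v pair_pre_digraph \<Rightarrow> 'v set \<Rightarrow> 'v \<Rightarrow> 'v set" where
  "neighbors_in G W v = {w \<in> W. (v, w) \<in> parcs G}"

text \<open>The four numbers are uniquely determined as soon as \<open>V\<close> and \<open>U\<close> are nonempty.\<close>

definition valence_condition :: "'v pair_pre_digraph \<Rightarrow> 'v set \<Rightarrow> 'v set \<Rightarrow> bool" where
  "valence_condition G V U \<longleftrightarrow>
     (\<exists>k1 k2 d1 d2.
        regular_of_valence (induce_subgraph (with_proj G) V) k1 \<and>
        regular_of_valence (induce_subgraph (with_proj G) U) k2 \<and>
        (\<forall>v \<in> V. card (neighbors_in G U v) = d1) \<and>
        (\<forall>u \<in> U. card (neighbors_in G V u) = d2) \<and>
        k1 * k2 = d1 * d2)"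

end

theory Submission
  imports Defs
begin

text \<open>Let \<open>A\<^sub>1, A\<^sub>2, A\<^sub>4, A\<^sub>5\<close> be the adjacency matrices of the four orbital graphs and
\<open>a\<^sub>1, a\<^sub>2, a\<^sub>4, a\<^sub>5\<close> their valences. The adjacency matrix of \<open>\<Gamma>\<close> has the diagonal blocks
\<open>A\<^sub>1 \<otimes> A\<^sub>4\<close>, \<open>A\<^sub>2 \<otimes> A\<^sub>5\<close> and the off-diagonal blocks \<open>I \<otimes> J\<close>. Its null vectors are treated as
functions on vertices whose neighbour sums vanish (\<open>singular_graph_iff\<close>, \<open>nut_graph_iff\<close>).

If \<open>\<Gamma>\<close> is a nut graph then \<open>A\<^sub>4\<close> is non-singular: a null vector of \<open>A\<^sub>4\<close> has coordinate sum zero,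
so copying it into every fibre of \<open>V\<close> and putting zeros on \<open>U\<close> gives a null vector of \<open>\<Gamma>\<close>, and no
nonzero null vector of a nut graph has a zero entry. The same holds for \<open>A\<^sub>5\<close>.

If all four factors are non-singular, then every null vector of \<open>\<Gamma>\<close> is constant on fibres
(\<open>fibre_constant\<close>), with value \<open>\<xi> i\<close> on the fibre of \<open>V\<close> over \<open>i\<close> and \<open>\<eta> i\<close> on that of \<open>U\<close>, where
\<open>a\<^sub>4 A\<^sub>1 \<xi> + t \<eta> = 0\<close> and \<open>a\<^sub>5 A\<^sub>2 \<eta> + m \<xi> = 0\<close>. Being a nut graph is now a property of this system
of \<open>2 n\<close> equations (\<open>nut_graph_iff_quotient_nut\<close>).

Suppose that the solutions form a line, spanned by a vector without zeros. Each element of \<open>G\<close>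
preserves the system, hence multiplies the solution by \<open>1\<close> or \<open>-1\<close>, so transitivity makes
\<open>\<bar>\<eta>\<bar>\<close> constant. As \<open>n\<close> is odd, the sum of \<open>\<eta>\<close> is nonzero, and adding up the equations over all \<open>i\<close>
yields \<open>a\<^sub>1 a\<^sub>4 a\<^sub>2 a\<^sub>5 = t m\<close>, which is the valence condition. Under this condition the constants
\<open>\<xi> = - t\<close>, \<open>\<eta> = a\<^sub>1 a\<^sub>4\<close>, cut off to a union of components of \<open>\<O>(\<Delta>\<^sub>1 \<union> \<Delta>\<^sub>2)\<close>, still form a
solution; so there is only one component.

Conversely, assume the valence condition and connectedness. For \<open>\<zeta> = - (a\<^sub>1 a\<^sub>4 / t) \<xi>\<close> the
system becomes \<open>A\<^sub>1 \<zeta> = a\<^sub>1 \<eta>\<close>, \<open>A\<^sub>2 \<eta> = a\<^sub>2 \<zeta>\<close>: each function averages the other. A sum of squares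
over arcs shows that \<open>\<eta> i = \<zeta> j\<close> for every arc \<open>(i, j)\<close> of either relation. Thus \<open>\<eta> + \<zeta>\<close> is constant,
and \<open>\<eta> - \<zeta>\<close> has constant absolute value and sum zero, so it vanishes because \<open>n\<close> is odd
(\<open>constant_of_coupled_averages\<close>). The solutions are therefore the multiples of the constant one.\<close>

section \<open>One-dimensional kernels\<close>

lemma (in kernel) lincomb_singleton:
  assumes "x \<in> mat_kernel A"
  shows "lincomb a {x} = a x \<cdot>\<^sub>v x"
  using assms mat_kernel_smult[OF A assms] unfolding Ker.lincomb_def by simp

lemma (in kernel) span_singleton:
  assumes "x \<in> mat_kernel A"
  shows "span {x} = range (\<lambda>c. c \<cdot>\<^sub>v x)"
proof -
  have "span {x} = {lincomb a {x} | a. a \<in> {x} \<rightarrow> UNIV}"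
    using assms Ker.finite_span[of "{x}"] by simp
  also have "\<dots> = range (\<lambda>c. c \<cdot>\<^sub>v x)"
    unfolding lincomb_singleton[OF assms] by auto
  finally show ?thesis .
qed

lemma (in kernel) dim_eq_1_if_span_singleton:
  assumes x: "x \<in> mat_kernel A" "x \<noteq> 0\<^sub>v nc" and sp: "span {x} = mat_kernel A"
  shows "dim = 1"
proof -
  have xc: "x \<in> carrier_vec nc" using mat_kernelD[OF A x(1)] by simp
  have "\<not> lin_dep {x}"
  proof (rule Ker.finite_lin_indpt2)
    fix a assume "lincomb a {x} = 0\<^sub>v nc"
    hence "a x \<cdot>\<^sub>v x = 0\<^sub>v nc" using lincomb_singleton[OF x(1)] by simp
    thus "\<forall>v\<in>{x}. a v = 0" using x(2) xc by (auto simp: vec_eq_iff)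
  qed (use x in auto)
  hence "basis {x}" using x sp by (auto simp: Ker.basis_def)
  from Ker.dim_basis[OF _ this] show ?thesis by simp
qed

section \<open>Null functions of a graph\<close>

text \<open>The adjacency matrix of \<open>R\<close> applied to \<open>f\<close>.\<close>

definition nbr_sum :: "'v rel \<Rightarrow> ('v \<Rightarrow> real) \<Rightarrow> 'v \<Rightarrow> real" where
  "nbr_sum R f v = (\<Sum>w\<in>R `` {v}. f w)"

text \<open>Null vectors of the adjacency matrix, indexed by the vertices themselves; this frees all later
arguments from the chosen enumeration of the vertices.\<close>

definition null_fun :: "'v pair_pre_digraph \<Rightarrow> ('v \<Rightarrow> real) \<Rightarrow> bool" where
  "null_fun G f \<longleftrightarrow> (\<forall>v\<in>pverts G. nbr_sum (parcs G) f v = 0)"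

definition vertex_vec :: "'v pair_pre_digraph \<Rightarrow> ('v \<Rightarrow> real) \<Rightarrow> real vec" where
  "vertex_vec G f = vec (card (pverts G)) (\<lambda>i. f (vertex_enum G ! i))"

lemma bij_betw_vertex_enum:
  assumes "finite (pverts G)"
  shows "bij_betw ((!) (vertex_enum G)) {..<card (pverts G)} (pverts G)"
  using bij_betw_nth[OF vertex_enum(1)[OF assms] refl refl] vertex_enum[OF assms]
  by (metis distinct_card)

lemma ball_vertex_enum:
  assumes "finite (pverts G)"
  shows "(\<forall>i<card (pverts G). P (vertex_enum G ! i)) \<longleftrightarrow> (\<forall>v\<in>pverts G. P v)"
proof -
  have "bij_betw ((!) (vertex_enum G)) {..<card (pverts G)} (pverts G)"
    by (rule bij_betw_vertex_enum[OF assms])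
  from bij_betw_imp_surj_on[OF this]
  have "v \<in> pverts G \<longleftrightarrow> (\<exists>i<card (pverts G). v = vertex_enum G ! i)" for v
    by (metis (no_types, lifting) image_iff lessThan_iff)
  thus ?thesis by (auto simp only: Ball_def)
qed

lemma vertex_vec_carrier [simp]: "vertex_vec G f \<in> carrier_vec (card (pverts G))"
  by (simp add: vertex_vec_def)

lemma vertex_vec_eq_iff:
  assumes "finite (pverts G)"
  shows "vertex_vec G f = vertex_vec G g \<longleftrightarrow> (\<forall>v\<in>pverts G. f v = g v)"
  unfolding ball_vertex_enum[OF assms, symmetric] by (auto simp: vertex_vec_def vec_eq_iff)

lemma smult_vertex_vec: "c \<cdot>\<^sub>v vertex_vec G f = vertex_vec G (\<lambda>v. c * f v)"
  by (auto simp: vertex_vec_def vec_eq_iff)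

lemma zero_vertex_vec: "0\<^sub>v (card (pverts G)) = vertex_vec G (\<lambda>_. 0)"
  by (auto simp: vertex_vec_def vec_eq_iff)

lemma vertex_vec_surj:
  assumes "finite (pverts G)" and "x \<in> carrier_vec (card (pverts G))"
  obtains f where "x = vertex_vec G f"
proof
  let ?f = "\<lambda>v. x $ the_inv_into {..<card (pverts G)} ((!) (vertex_enum G)) v"
  show "x = vertex_vec G ?f"
    using assms(2) bij_betw_imp_inj_on[OF bij_betw_vertex_enum[OF assms(1)]]
    by (auto simp: vertex_vec_def vec_eq_iff the_inv_into_f_f)
qed

lemma adj_matrix_carrier [simp]:
  "adj_matrix G \<in> carrier_mat (card (pverts G)) (card (pverts G))"
  by (simp add: adj_matrix_def)

lemma adj_matrix_mult_vertex_vec: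
  assumes "pair_fin_digraph G"
  shows "adj_matrix G *\<^sub>v vertex_vec G f = vertex_vec G (nbr_sum (parcs G) f)"
proof (rule eq_vecI)
  interpret pair_fin_digraph G by fact
  let ?e = "(!) (vertex_enum G)" and ?N = "card (pverts G)"
  fix i assume "i < dim_vec (vertex_vec G (nbr_sum (parcs G) f))"
  hence i: "i < ?N" by (simp add: vertex_vec_def)
  have "(adj_matrix G *\<^sub>v vertex_vec G f) $ i
      = (\<Sum>j<?N. if (?e i, ?e j) \<in> parcs G then f (?e j) else 0)"
    using i by (auto simp: adj_matrix_def vertex_vec_def scalar_prod_def atLeast0LessThan intro!: sum.cong)
  also have "\<dots> = (\<Sum>w\<in>pverts G. if (?e i, w) \<in> parcs G then f w else 0)"
    by (rule sum.reindex_bij_betw[OF bij_betw_vertex_enum[OF pair_finite_verts]])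
  also have "\<dots> = (\<Sum>w\<in>pverts G \<inter> {w. (?e i, w) \<in> parcs G}. f w)"
    using pair_finite_verts by (intro sum.mono_neutral_cong_right) auto
  also have "pverts G \<inter> {w. (?e i, w) \<in> parcs G} = parcs G `` {?e i}"
    using in_arcsD2 by auto
  finally show "(adj_matrix G *\<^sub>v vertex_vec G f) $ i = vertex_vec G (nbr_sum (parcs G) f) $ i"
    using i by (simp add: vertex_vec_def nbr_sum_def)
qed (simp add: adj_matrix_def vertex_vec_def)

lemma vertex_vec_in_kernel_iff:
  assumes "pair_fin_digraph G"
  shows "vertex_vec G f \<in> mat_kernel (adj_matrix G) \<longleftrightarrow> null_fun G f"
proof -
  interpret pair_fin_digraph G by fact
  show ?thesis
    unfolding mat_kernel[OF adj_matrix_carrier] null_fun_def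
    by (simp add: adj_matrix_mult_vertex_vec[OF assms] zero_vertex_vec vertex_vec_eq_iff[OF pair_finite_verts])
qed

lemma mat_kernel_adj_matrix:
  assumes "pair_fin_digraph G"
  shows "mat_kernel (adj_matrix G) = vertex_vec G ` {f. null_fun G f}"
proof -
  interpret pair_fin_digraph G by fact
  show ?thesis
  proof (intro equalityI subsetI)
    fix x assume x: "x \<in> mat_kernel (adj_matrix G)"
    obtain f where "x = vertex_vec G f"
      using vertex_vec_surj[OF pair_finite_verts mat_kernelD(1)[OF adj_matrix_carrier x]] .
    thus "x \<in> vertex_vec G ` {f. null_fun G f}"
      using x vertex_vec_in_kernel_iff[OF assms] by auto
  qed (use vertex_vec_in_kernel_iff[OF assms] in auto)
qed

lemma singular_graph_iff:
  assumes "pair_fin_digraph G"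
  shows "singular_graph G \<longleftrightarrow> (\<exists>f. null_fun G f \<and> (\<exists>v\<in>pverts G. f v \<noteq> 0))"
proof -
  interpret pair_fin_digraph G by fact
  note fin = pair_finite_verts
  let ?N = "card (pverts G)"
  have zero: "0 \<cdot>\<^sub>v x = 0\<^sub>v ?N" if "x \<in> carrier_vec ?N" for x :: "real vec"
    using that by (intro eq_vecI) auto
  have "singular_graph G \<longleftrightarrow> (\<exists>x\<in>mat_kernel (adj_matrix G). x \<noteq> 0\<^sub>v ?N)"
    unfolding singular_graph_def eigenvalue_def eigenvector_def mat_kernel[OF adj_matrix_carrier]
    using zero by (auto simp: carrier_matD[OF adj_matrix_carrier])
  also have "\<dots> \<longleftrightarrow> (\<exists>f. null_fun G f \<and> vertex_vec G f \<noteq> 0\<^sub>v ?N)"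
    unfolding mat_kernel_adj_matrix[OF assms] by blast
  finally show ?thesis
    unfolding zero_vertex_vec vertex_vec_eq_iff[OF fin] by blast
qed

text \<open>A full vector spanning the kernel is nonzero as soon as there is a vertex, and then the kernel
has dimension one. Without vertices the condition on the right would hold vacuously, whereas the
kernel would have dimension zero.\<close>

lemma nut_graph_iff:
  assumes "pair_fin_digraph G" and "pverts G \<noteq> {}"
  shows "nut_graph G \<longleftrightarrow> pair_graph G \<and>
    (\<exists>f. null_fun G f \<and> (\<forall>v\<in>pverts G. f v \<noteq> 0) \<and>
         (\<forall>g. null_fun G g \<longrightarrow> (\<exists>c. \<forall>v\<in>pverts G. g v = c * f v)))"
proof -
  interpret pair_fin_digraph G by fact
  note fin = pair_finite_verts
  let ?A = "adj_matrix G" and ?N = "card (pverts G)"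
  interpret kernel ?N ?N ?A by unfold_locales simp
  have dim_A: "dim_col ?A = ?N" by (simp add: adj_matrix_def)
  have nz: "(\<forall>i<dim_vec (vertex_vec G f). vertex_vec G f $ i \<noteq> 0) \<longleftrightarrow> (\<forall>v\<in>pverts G. f v \<noteq> 0)" for f
    using ball_vertex_enum[OF fin, of "\<lambda>v. f v \<noteq> 0"] by (auto simp: vertex_vec_def)
  have sp: "span {vertex_vec G f} = mat_kernel ?A \<longleftrightarrow>
      (\<forall>g. null_fun G g \<longrightarrow> (\<exists>c. \<forall>v\<in>pverts G. g v = c * f v))" if f: "null_fun G f" for f
  proof -
    have fk: "vertex_vec G f \<in> mat_kernel ?A" using f vertex_vec_in_kernel_iff[OF assms(1)] by simp
    have "span {vertex_vec G f} = mat_kernel ?A \<longleftrightarrow>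
        mat_kernel ?A \<subseteq> range (\<lambda>c. c \<cdot>\<^sub>v vertex_vec G f)"
      unfolding span_singleton[OF fk] using mat_kernel_smult[OF A fk] by auto
    also have "\<dots> \<longleftrightarrow> (\<forall>g. null_fun G g \<longrightarrow> vertex_vec G g \<in> range (\<lambda>c. c \<cdot>\<^sub>v vertex_vec G f))"
      unfolding mat_kernel_adj_matrix[OF assms(1)] by blast
    finally show ?thesis
      by (simp add: image_iff smult_vertex_vec vertex_vec_eq_iff[OF fin])
  qed
  have one: "kernel_dim ?A = 1"
    if "null_fun G f" "\<forall>v\<in>pverts G. f v \<noteq> 0" "span {vertex_vec G f} = mat_kernel ?A" for f
    using that assms(2) vertex_vec_in_kernel_iff[OF assms(1)]
    by (subst kernel_dim, intro dim_eq_1_if_span_singleton)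
       (auto simp: zero_vertex_vec vertex_vec_eq_iff[OF fin])
  have "nut_graph G \<longleftrightarrow> pair_graph G \<and> kernel_dim ?A = 1 \<and>
     (\<exists>f. null_fun G f \<and> span {vertex_vec G f} = mat_kernel ?A \<and> (\<forall>v\<in>pverts G. f v \<noteq> 0))"
    unfolding nut_graph_def dim_A nz[symmetric]
    unfolding mat_kernel_adj_matrix[OF assms(1)] by blast
  thus ?thesis using sp one by blast
qed

section \<open>Regular symmetric relations\<close>

definition regular_rel :: "nat \<Rightarrow> nat rel \<Rightarrow> nat \<Rightarrow> bool" where
  "regular_rel n R a \<longleftrightarrow> R \<subseteq> {..<n} \<times> {..<n} \<and> sym R \<and> (\<forall>i<n. card (R `` {i}) = a)"

text \<open>Connectedness in the form in which it is used: a nonempty vertex set that is closed under taking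
neighbours is everything.\<close>

definition closed_connected :: "nat \<Rightarrow> nat rel \<Rightarrow> bool" where
  "closed_connected n R \<longleftrightarrow> (\<forall>S. S \<subseteq> {..<n} \<longrightarrow> S \<noteq> {} \<longrightarrow> R `` S \<subseteq> S \<longrightarrow> S = {..<n})"

lemma nbr_sum_diff: "nbr_sum R (\<lambda>w. f w - g w) v = nbr_sum R f v - nbr_sum R g v"
  by (simp add: nbr_sum_def sum_subtractf)

lemma nbr_sum_scale: "nbr_sum R (\<lambda>w. c * f w) v = c * nbr_sum R f v"
  by (simp add: nbr_sum_def sum_distrib_left)

lemma nbr_sum_swap:
  "nbr_sum R (\<lambda>i'. nbr_sum Q (\<lambda>j'. x i' j') j) i = nbr_sum Q (\<lambda>j'. nbr_sum R (\<lambda>i'. x i' j') i) j"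
  unfolding nbr_sum_def by (rule sum.swap)

lemma regular_relD:
  assumes "regular_rel n R a"
  shows "R \<subseteq> {..<n} \<times> {..<n}" "sym R" "\<And>i. i < n \<Longrightarrow> card (R `` {i}) = a"
    "finite R" "R `` {i} \<subseteq> {..<n}" "finite (R `` {i})"
proof -
  show "R \<subseteq> {..<n} \<times> {..<n}" "sym R" "\<And>i. i < n \<Longrightarrow> card (R `` {i}) = a"
    using assms by (auto simp: regular_rel_def)
  thus "finite R" "R `` {i} \<subseteq> {..<n}" by (auto intro: finite_subset)
  thus "finite (R `` {i})" using finite_subset by blast
qed

lemma nbr_sum_const:
  assumes "regular_rel n R a" "i < n"
  shows "nbr_sum R (\<lambda>_. c) i = a * c"
  using regular_relD(3)[OF assms] by (simp add: nbr_sum_def)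

text \<open>By symmetry no arc joins \<open>S\<close> to its complement.\<close>

lemma nbr_sum_closed:
  assumes R: "regular_rel n R a" and S: "R `` S \<subseteq> S" and "i < n"
  shows "nbr_sum R (\<lambda>j. if j \<in> S then c else 0) i = (if i \<in> S then a * c else 0)"
proof -
  have "nbr_sum R (\<lambda>j. if j \<in> S then c else 0) i = (\<Sum>j\<in>R `` {i}. if i \<in> S then c else 0)"
    unfolding nbr_sum_def
    using S regular_relD(2)[OF R] by (intro sum.cong) (auto simp: sym_def)
  thus ?thesis using regular_relD(3)[OF R \<open>i < n\<close>] by simp
qed

text \<open>The adjacency matrix of a symmetric relation is symmetric.\<close>

lemma nbr_sum_adjoint:
  assumes "regular_rel n R a"
  shows "(\<Sum>i<n. g i * nbr_sum R f i) = (\<Sum>i<n. f i * nbr_sum R g i)"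
proof -
  have "(\<Sum>i<n. g i * nbr_sum R f i) = (\<Sum>i<n. \<Sum>j<n. if (i, j) \<in> R then g i * f j else 0)" for f g
  proof (rule sum.cong[OF refl])
    fix i
    have "g i * nbr_sum R f i = (\<Sum>j\<in>{..<n} \<inter> {j. (i, j) \<in> R}. g i * f j)"
      unfolding nbr_sum_def sum_distrib_left
      using regular_relD(5)[OF assms, of i] by (intro sum.cong) auto
    thus "g i * nbr_sum R f i = (\<Sum>j<n. if (i, j) \<in> R then g i * f j else 0)"
      by (simp add: sum.inter_restrict)
  qed
  from this[of g f] this[of f g] show ?thesis
    using regular_relD(2)[OF assms]
    by (subst (asm) sum.swap) (auto simp: sym_def mult.commute intro!: sum.cong)
qed

lemma sum_nbr_sum:
  assumes "regular_rel n R a"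
  shows "(\<Sum>i<n. nbr_sum R f i) = a * (\<Sum>i<n. f i)"
  using nbr_sum_adjoint[OF assms, of "\<lambda>_. 1" f] nbr_sum_const[OF assms, of _ 1]
  by (simp add: sum_distrib_left mult.commute)

lemma sum_null_eq_0:
  assumes "regular_rel l R a" "a > 0" "\<And>j. j < l \<Longrightarrow> nbr_sum R w j = 0"
  shows "(\<Sum>j<l. w j) = 0"
  using sum_nbr_sum[OF assms(1), of w] assms(2,3) by simp

text \<open>A Dirichlet form: when \<open>nbr_sum R g = a f\<close>, its value is \<open>a\<close> times the difference of the squared
norms of \<open>g\<close> and \<open>f\<close>.\<close>

lemma sum_arc_differences_squared:
  assumes "regular_rel n R a"
  shows "(\<Sum>i<n. \<Sum>j\<in>R `` {i}. (f i - g j)\<^sup>2)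
    = a * (\<Sum>i<n. (f i)\<^sup>2) + a * (\<Sum>i<n. (g i)\<^sup>2) - 2 * (\<Sum>i<n. f i * nbr_sum R g i)"
proof -
  have "(\<Sum>i<n. \<Sum>j\<in>R `` {i}. (f i - g j)\<^sup>2)
      = (\<Sum>i<n. a * (f i)\<^sup>2 + nbr_sum R (\<lambda>j. (g j)\<^sup>2) i - 2 * (f i * nbr_sum R g i))"
    using regular_relD(3)[OF assms]
    by (intro sum.cong)
       (simp_all add: nbr_sum_def power2_diff sum.distrib sum_subtractf sum_distrib_left mult.assoc)
  thus ?thesis
    by (simp add: sum.distrib sum_subtractf sum_nbr_sum[OF assms] sum_distrib_left)
qed

text \<open>Dividing by \<open>c\<close> turns the sum into a sum of an odd number of signs, which is an odd integer.\<close>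

lemma odd_sum_of_signs_nonzero:
  fixes W :: "nat \<Rightarrow> real"
  assumes "odd n" "\<And>i. i < n \<Longrightarrow> \<bar>W i\<bar> = c" "c \<noteq> 0"
  shows "(\<Sum>i<n. W i) \<noteq> 0"
proof -
  have "\<exists>k::int. (\<Sum>i<l. W i) = c * of_int k \<and> (even k \<longleftrightarrow> even l)" if "l \<le> n" for l
    using that
  proof (induction l)
    case (Suc l)
    then obtain k :: int where k: "(\<Sum>i<l. W i) = c * of_int k" "even k \<longleftrightarrow> even l" by auto
    have "W l = c * of_int 1 \<or> W l = c * of_int (- 1)" using assms(2)[of l] Suc.prems by (auto simp: abs_if)
    then obtain s :: int where "W l = c * of_int s" "odd s"
      by (metis dvd_minus_iff odd_one)
    with k show ?case by (intro exI[of _ "k + s"]) (auto simp: algebra_simps)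
  qed (auto intro: exI[of _ 0])
  from this[of n] show ?thesis using assms(1,3) by auto
qed

text \<open>The two Dirichlet forms are \<open>a (z - y)\<close> and \<open>b (y - z)\<close> with \<open>y\<close>, \<open>z\<close> the squared norms of \<open>Y\<close>, \<open>Z\<close>.
Both are nonnegative, so both vanish, and \<open>Y i = Z j\<close> along every arc of either relation. Oddness of \<open>n\<close>
excludes the solutions of a bipartite graph with \<open>Y = - Z\<close> and opposite signs on the two halves.\<close>

lemma constant_of_coupled_averages:
  assumes R1: "regular_rel n R1 a" and R2: "regular_rel n R2 b" and "a > 0" "b > 0"
    and odd: "odd n" and conn: "closed_connected n (R1 \<union> R2)"
    and YZ: "\<And>i. i < n \<Longrightarrow> nbr_sum R1 Z i = a * Y i"
    and ZY: "\<And>i. i < n \<Longrightarrow> nbr_sum R2 Y i = b * Z i"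
  shows "\<exists>c. \<forall>i<n. Y i = c \<and> Z i = c"
proof -
  define y where "y = (\<Sum>i<n. (Y i)\<^sup>2)"
  define z where "z = (\<Sum>i<n. (Z i)\<^sup>2)"
  have e1: "(\<Sum>i<n. \<Sum>j\<in>R1 `` {i}. (Y i - Z j)\<^sup>2) = a * (z - y)"
    unfolding sum_arc_differences_squared[OF R1] y_def z_def using YZ
    by (simp add: power2_eq_square sum_distrib_left algebra_simps)
  have e2: "(\<Sum>i<n. \<Sum>j\<in>R2 `` {i}. (Z i - Y j)\<^sup>2) = b * (y - z)"
    unfolding sum_arc_differences_squared[OF R2] y_def z_def using ZY
    by (simp add: power2_eq_square sum_distrib_left algebra_simps)
  have "0 \<le> a * (z - y)" unfolding e1[symmetric] by (intro sum_nonneg) auto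
  moreover have "0 \<le> b * (y - z)" unfolding e2[symmetric] by (intro sum_nonneg) auto
  ultimately have "y = z" using \<open>a > 0\<close> \<open>b > 0\<close> by (simp add: zero_le_mult_iff)
  have 1: "Y i = Z j" if "(i, j) \<in> R1" for i j
  proof -
    have "i < n" using that regular_relD(1)[OF R1] by auto
    hence "(\<Sum>j\<in>R1 `` {i}. (Y i - Z j)\<^sup>2) = 0"
      using e1 \<open>y = z\<close> by (auto simp: sum_nonneg_eq_0_iff sum_nonneg)
    thus ?thesis using that regular_relD(6)[OF R1] by (subst (asm) sum_nonneg_eq_0_iff) auto
  qed
  have 2: "Z i = Y j" if "(i, j) \<in> R2" for i j
  proof -
    have "i < n" using that regular_relD(1)[OF R2] by auto
    hence "(\<Sum>j\<in>R2 `` {i}. (Z i - Y j)\<^sup>2) = 0"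
      using e2 \<open>y = z\<close> by (auto simp: sum_nonneg_eq_0_iff sum_nonneg)
    thus ?thesis using that regular_relD(6)[OF R2] by (subst (asm) sum_nonneg_eq_0_iff) auto
  qed
  have swap: "Y i = Z j \<and> Z i = Y j" if "(i, j) \<in> R1 \<union> R2" for i j
    using that 1[of i j] 1[of j i] 2[of i j] 2[of j i] regular_relD(2)[OF R1] regular_relD(2)[OF R2]
    by (auto simp: sym_def)
  have "0 < n" using odd by (cases n) auto
  have all: "\<forall>i<n. P i" if "P 0" "\<And>i j. P i \<Longrightarrow> (i, j) \<in> R1 \<union> R2 \<Longrightarrow> P j" for P
  proof -
    have "{i. i < n \<and> P i} = {..<n}"
      using conn[unfolded closed_connected_def, rule_format, of "{i. i < n \<and> P i}"] that \<open>0 < n\<close>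
        regular_relD(1)[OF R1] regular_relD(1)[OF R2] by blast
    thus ?thesis by auto
  qed
  \<comment> \<open>Crossing an arc exchanges the two values, so the sum is unchanged and the difference changes sign.\<close>
  have p: "\<forall>i<n. Y i + Z i = Y 0 + Z 0"
  proof (rule all)
    fix i j assume "Y i + Z i = Y 0 + Z 0" "(i, j) \<in> R1 \<union> R2"
    thus "Y j + Z j = Y 0 + Z 0" using swap[of i j] by linarith
  qed simp
  define W where "W = (\<lambda>i. Y i - Z i)"
  have absW: "\<forall>i<n. \<bar>W i\<bar> = \<bar>W 0\<bar>"
  proof (rule all)
    fix i j assume "\<bar>W i\<bar> = \<bar>W 0\<bar>" "(i, j) \<in> R1 \<union> R2"
    thus "\<bar>W j\<bar> = \<bar>W 0\<bar>" using swap[of i j] unfolding W_def by linarith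
  qed simp
  have "(\<Sum>i<n. W i) = 0"
  proof -
    have "nbr_sum R1 W i = - (a * W i)" if "i < n" for i
    proof -
      have "nbr_sum R1 W i = (\<Sum>j\<in>R1 `` {i}. - W i)"
        unfolding nbr_sum_def
      proof (rule sum.cong[OF refl])
        fix j assume "j \<in> R1 `` {i}"
        thus "W j = - W i" using swap[of i j] by (simp add: W_def)
      qed
      thus ?thesis using regular_relD(3)[OF R1 that] by simp
    qed
    hence "(\<Sum>i<n. nbr_sum R1 W i) = (\<Sum>i<n. - (a * W i))" by simp
    thus ?thesis unfolding sum_nbr_sum[OF R1] using \<open>a > 0\<close>
      by (simp add: sum_negf sum_distrib_left[symmetric])
  qed
  moreover have "(\<Sum>i<n. W i) \<noteq> 0" if "\<bar>W 0\<bar> \<noteq> 0"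
    using absW[rule_format] that by (rule odd_sum_of_signs_nonzero[OF odd])
  ultimately have "\<bar>W 0\<bar> = 0" by blast
  hence "\<forall>i<n. W i = 0" using absW by (metis abs_eq_0)
  have "Y i = (Y 0 + Z 0) / 2 \<and> Z i = (Y 0 + Z 0) / 2" if "i < n" for i
  proof -
    have "Y i + Z i = Y 0 + Z 0" using p that by blast
    moreover have "Y i - Z i = 0" using \<open>\<forall>i<n. W i = 0\<close> that unfolding W_def by blast
    ultimately show ?thesis by simp
  qed
  thus ?thesis by blast
qed

section \<open>Orbitals of transitive groups\<close>

lemma transitive_perm_groupD:
  assumes "transitive_perm_group n G"
  shows "g \<in> G \<Longrightarrow> bij_betw g {..<n} {..<n}"
    and "g \<in> G \<Longrightarrow> h \<in> G \<Longrightarrow> compose {..<n} g h \<in> G"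
    and "i < n \<Longrightarrow> j < n \<Longrightarrow> \<exists>g\<in>G. g i = j"
    and "\<exists>g\<in>G. \<forall>i<n. g i = i"
proof -
  have sub: "subgroup G (BijGroup {..<n})"
    and act: "transitive_action (perm_group n G) {..<n} (\<lambda>g. g)"
    using assms by (auto simp: transitive_perm_group_def)
  have G: "G \<subseteq> Bij {..<n}" using subgroup.subset[OF sub] by (simp add: BijGroup_def)
  show "g \<in> G \<Longrightarrow> bij_betw g {..<n} {..<n}" using G by (auto simp: Bij_def)
  show "compose {..<n} g h \<in> G" if "g \<in> G" "h \<in> G"
    using subgroup.m_closed[OF sub that] subsetD[OF G that(1)] subsetD[OF G that(2)]
    by (simp add: BijGroup_def)
  show "i < n \<Longrightarrow> j < n \<Longrightarrow> \<exists>g\<in>G. g i = j"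
    using transitive_action.unique_orbit[OF act, of i j] by simp
  show "\<exists>g\<in>G. \<forall>i<n. g i = i"
    using subgroup.one_closed[OF sub] by (intro bexI[of _ "\<lambda>i\<in>{..<n}. i"]) (auto simp: BijGroup_def)
qed

definition rel_automorphism :: "nat \<Rightarrow> nat rel \<Rightarrow> (nat \<Rightarrow> nat) \<Rightarrow> bool" where
  "rel_automorphism n R g \<longleftrightarrow> bij_betw g {..<n} {..<n} \<and> (\<forall>(x, y)\<in>R. (g x, g y) \<in> R)"

context
  fixes n G R
  assumes trans: "transitive_perm_group n G" and orb: "R \<in> orbitals n G"
begin

lemma orbitalE:
  obtains x y where "x < n" "y < n" "R = {(g x, g y) | g. g \<in> G}"
  using orb unfolding orbitals_def Group_Action.orbits_def Group_Action.orbit_def by auto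

lemma orbital_subset: "R \<subseteq> {..<n} \<times> {..<n}"
proof -
  obtain x y where "x < n" "y < n" "R = {(g x, g y) | g. g \<in> G}" by (rule orbitalE)
  thus ?thesis using bij_betw_apply[OF transitive_perm_groupD(1)[OF trans]] by auto
qed

lemma orbital_nonempty: "R \<noteq> {}"
  using transitive_perm_groupD(4)[OF trans] by (rule_tac orbitalE) auto

lemma orbital_automorphism:
  assumes "g \<in> G"
  shows "rel_automorphism n R g"
proof -
  obtain x y where xy: "x < n" "y < n" "R = {(g x, g y) | g. g \<in> G}" by (rule orbitalE)
  have "(g (h x), g (h y)) \<in> R" if "h \<in> G" for h
    unfolding xy(3) using transitive_perm_groupD(2)[OF trans assms that] xy(1,2)
    by (auto simp: compose_def intro!: exI[of _ "compose {..<n} g h"])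
  thus ?thesis using transitive_perm_groupD(1)[OF trans assms] xy(3)
    by (auto simp: rel_automorphism_def)
qed

text \<open>By injectivity such an orbital is the orbit of a diagonal pair.\<close>

lemma orbital_diagonal:
  assumes "(i, i) \<in> R"
  shows "R = diagonal_orbital n"
proof -
  obtain x y where xy: "x < n" "y < n" "R = {(g x, g y) | g. g \<in> G}" by (rule orbitalE)
  obtain g where g: "g \<in> G" "g x = g y" using assms xy(3) by auto
  have "x = y" using bij_betw_imp_inj_on[OF transitive_perm_groupD(1)[OF trans g(1)]] g(2) xy(1,2)
    by (auto simp: inj_on_def)
  show ?thesis
  proof
    show "R \<subseteq> diagonal_orbital n"
      using orbital_subset xy(3) \<open>x = y\<close> by (auto simp: diagonal_orbital_def)
    show "diagonal_orbital n \<subseteq> R"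
    proof
      fix p assume "p \<in> diagonal_orbital n"
      then obtain j where j: "p = (j, j)" "j < n" by (auto simp: diagonal_orbital_def)
      obtain g where "g \<in> G" "g x = j" using transitive_perm_groupD(3)[OF trans xy(1) j(2)] by auto
      thus "p \<in> R" using xy(3) \<open>x = y\<close> j(1) by auto
    qed
  qed
qed

text \<open>A permutation in the group taking \<open>i\<close> to \<open>j\<close> maps the neighbours of \<open>i\<close> injectively to those of
\<open>j\<close>; transitivity gives this in both directions.\<close>

lemma orbital_regular:
  assumes "self_paired R"
  shows "\<exists>a>0. regular_rel n R a"
proof -
  have fin: "finite (R `` {i})" for i
    using orbital_subset finite_subset[of "R `` {i}" "{..<n}"] by auto
  have le: "card (R `` {i}) \<le> card (R `` {j})" if ij: "i < n" "j < n" for i j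
  proof -
    obtain g where g: "g \<in> G" "g i = j" using transitive_perm_groupD(3)[OF trans ij] by auto
    have "g ` (R `` {i}) \<subseteq> R `` {j}"
      using orbital_automorphism[OF g(1)] g(2) by (auto simp: rel_automorphism_def)
    moreover have "inj_on g (R `` {i})"
      using bij_betw_imp_inj_on[OF transitive_perm_groupD(1)[OF trans g(1)]]
      by (rule inj_on_subset) (use orbital_subset in auto)
    ultimately show ?thesis using card_inj_on_le fin by blast
  qed
  obtain x y where xy: "(x, y) \<in> R" using orbital_nonempty by auto
  hence "x < n" using orbital_subset by auto
  have "card (R `` {x}) > 0" using xy fin by (auto simp: card_gt_0_iff)
  moreover have "regular_rel n R (card (R `` {x}))"
    using assms orbital_subset le \<open>x < n\<close>
    by (auto simp: regular_rel_def self_paired_def sym_def intro!: le_antisym)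
  ultimately show ?thesis by blast
qed

end

text \<open>An automorphism maps the neighbours of \<open>i\<close> into those of \<open>g i\<close>; both sets have the same size, so
it maps them onto.\<close>

lemma nbr_sum_automorphism:
  assumes R: "regular_rel n R a" and g: "rel_automorphism n R g" and "i < n"
  shows "nbr_sum R (\<lambda>j. f (g j)) i = nbr_sum R f (g i)"
proof -
  have bij: "bij_betw g {..<n} {..<n}" using g by (simp add: rel_automorphism_def)
  have inj: "inj_on g (R `` {i})"
    using bij_betw_imp_inj_on[OF bij] regular_relD(5)[OF R] by (rule inj_on_subset)
  have "g i < n" using bij_betw_apply[OF bij] \<open>i < n\<close> by auto
  have "g ` (R `` {i}) = R `` {g i}"
  proof (rule card_subset_eq[OF regular_relD(6)[OF R]])
    show "g ` (R `` {i}) \<subseteq> R `` {g i}" using g by (auto simp: rel_automorphism_def)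
    show "card (g ` (R `` {i})) = card (R `` {g i})"
      using card_image[OF inj] regular_relD(3)[OF R] \<open>i < n\<close> \<open>g i < n\<close> by simp
  qed
  thus ?thesis using sum.reindex[OF inj, of f] by (simp add: nbr_sum_def)
qed

lemma orbital_graph_fin:
  assumes "R \<subseteq> {..<n} \<times> {..<n}"
  shows "pair_fin_digraph (orbital_graph n R)"
  using assms finite_subset[OF assms] by unfold_locales (auto simp: orbital_graph_def)

lemma nonsingular_orbital_graph_iff:
  assumes "R \<subseteq> {..<n} \<times> {..<n}"
  shows "\<not> singular_graph (orbital_graph n R) \<longleftrightarrow>
    (\<forall>f. (\<forall>i<n. nbr_sum R f i = 0) \<longrightarrow> (\<forall>i<n. f i = 0))"
  unfolding singular_graph_iff[OF orbital_graph_fin[OF assms]]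
  by (auto simp: null_fun_def orbital_graph_def)

text \<open>The vertices reachable from a given one form a closed set, and a closed set contains with a vertex
everything reachable from it.\<close>

lemma connected_orbital_graph_iff:
  assumes R: "R \<subseteq> {..<n} \<times> {..<n}" and "sym R" and "n > 0"
  shows "Digraph_Component.connected (with_proj (orbital_graph n R)) \<longleftrightarrow> closed_connected n R"
proof -
  have mk: "parcs (mk_symmetric (with_proj (orbital_graph n R))) = R"
    using \<open>sym R\<close> by (auto simp: parcs_mk_symmetric orbital_graph_def sym_def)
  have verts: "pverts (orbital_graph n R) = {..<n}" by (simp add: orbital_graph_def)
  have conn: "Digraph_Component.connected (with_proj (orbital_graph n R)) \<longleftrightarrow>
      (\<forall>u<n. \<forall>v<n. (u, v) \<in> rtrancl_on {..<n} R)"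
    using \<open>n > 0\<close> unfolding connected_def strongly_connected_def reachable_def
    by (simp add: mk verts Ball_def lessThan_empty_iff)
  show ?thesis
    unfolding conn
  proof
    assume *: "\<forall>u<n. \<forall>v<n. (u, v) \<in> rtrancl_on {..<n} R"
    show "closed_connected n R"
      unfolding closed_connected_def
    proof (intro allI impI equalityI subsetI)
      fix S v assume S: "S \<subseteq> {..<n}" "S \<noteq> {}" "R `` S \<subseteq> S" and v: "v \<in> {..<n}"
      obtain u where u: "u \<in> S" using S(2) by auto
      have "(u, v) \<in> rtrancl_on {..<n} R" using * S(1) u v by auto
      thus "v \<in> S"
      proof (induction rule: rtrancl_on_induct)
        case base
        show ?case by (rule u)
      next
        case (step y z)
        thus ?case using S(3) by auto
      qed
    qed auto
  next
    assume *: "closed_connected n R"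
    show "\<forall>u<n. \<forall>v<n. (u, v) \<in> rtrancl_on {..<n} R"
    proof (intro allI impI)
      fix u v assume uv: "u < n" "v < n"
      let ?S = "{w. (u, w) \<in> rtrancl_on {..<n} R}"
      have "?S = {..<n}"
      proof (rule *[unfolded closed_connected_def, rule_format])
        show "?S \<subseteq> {..<n}" using in_rtrancl_on_in_F by fastforce
        show "?S \<noteq> {}" using uv(1) by (auto intro!: exI[of _ u])
        show "R `` ?S \<subseteq> ?S" using R by (auto intro: rtrancl_on_into_rtrancl_on)
      qed
      thus "(u, v) \<in> rtrancl_on {..<n} R" using uv(2) by auto
    qed
  qed
qed

text \<open>The left-hand side is \<open>R \<otimes> Q\<close> applied to \<open>x\<close>, and the right-hand side depends on the first
coordinate only. Non-singularity of \<open>Q\<close> shows that applying \<open>R\<close> alone already gives a function that is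
constant in the second coordinate, namely \<open>s / b\<close>. Non-singularity of \<open>R\<close> then removes \<open>R\<close>.\<close>

lemma fibre_constant:
  assumes R: "regular_rel n R a" and Q: "regular_rel m Q b" "b > 0"
    and nR: "\<not> singular_graph (orbital_graph n R)"
    and nQ: "\<not> singular_graph (orbital_graph m Q)"
    and eq: "\<And>i j. i < n \<Longrightarrow> j < m \<Longrightarrow> nbr_sum R (\<lambda>i'. nbr_sum Q (\<lambda>j'. x i' j') j) i = s i"
    and "i < n" "j < m" "j' < m"
  shows "x i j = x i j'"
proof -
  note ns = nonsingular_orbital_graph_iff[THEN iffD1, rule_format]
  have z: "nbr_sum R (\<lambda>i'. x i' l) k = s k / b" if "k < n" "l < m" for k l
  proof -
    have "nbr_sum R (\<lambda>i'. x i' l) k - s k / b = 0"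
    proof (rule ns[OF regular_relD(1)[OF Q(1)] nQ, of "\<lambda>l. nbr_sum R (\<lambda>i'. x i' l) k - s k / b", OF _ \<open>l < m\<close>])
      fix l assume "l < m"
      thus "nbr_sum Q (\<lambda>l. nbr_sum R (\<lambda>i'. x i' l) k - s k / b) l = 0"
        using eq[OF \<open>k < n\<close>] \<open>b > 0\<close>
        by (simp add: nbr_sum_diff nbr_sum_const[OF Q(1)] nbr_sum_swap[of R Q])
    qed
    thus ?thesis by simp
  qed
  have "x i j - x i j' = 0"
    by (rule ns[OF regular_relD(1)[OF R] nR, of "\<lambda>i. x i j - x i j'", OF _ \<open>i < n\<close>]) (simp add: nbr_sum_diff z assms(8,9))
  thus ?thesis by simp
qed

section \<open>The graph \<open>\<Gamma>\<close> and its null functions\<close>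

lemma sum_image_Times:
  assumes "inj h"
  shows "(\<Sum>v\<in>h ` (A \<times> B). f v) = (\<Sum>i\<in>A. \<Sum>j\<in>B. f (h (i, j)))"
  using inj_on_subset[OF assms, of "A \<times> B"]
  by (simp add: sum.reindex sum.cartesian_product case_prod_beta')

text \<open>The graph depends on the groups only through the four relations; what matters about these is that
they are symmetric and regular of positive valence.\<close>

locale fibred_graph =
  fixes n m t :: nat and R1 R2 R4 R5 :: "nat rel" and a1 a2 a4 a5 :: nat
  assumes R1: "regular_rel n R1 a1" and R2: "regular_rel n R2 a2"
    and R4: "regular_rel m R4 a4" and R5: "regular_rel t R5 a5"
    and pos: "n > 0" "m > 0" "t > 0" "a1 > 0" "a2 > 0" "a4 > 0" "a5 > 0"
begin

definition \<Gamma> :: "gvertex pair_pre_digraph" where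
  "\<Gamma> = Gamma_graph n m t R1 R2 (diagonal_orbital n) R4 R5"

lemma verts_Gamma: "pverts \<Gamma> = Inl ` ({..<n} \<times> {..<m}) \<union> Inr ` ({..<n} \<times> {..<t})"
  by (auto simp: \<Gamma>_def Gamma_graph_def Let_def V_part_def U_part_def)

lemma ball_verts_Gamma:
  "(\<forall>v\<in>pverts \<Gamma>. P v) \<longleftrightarrow> (\<forall>i<n. \<forall>j<m. P (Inl (i, j))) \<and> (\<forall>i<n. \<forall>j<t. P (Inr (i, j)))"
  by (auto simp: verts_Gamma)

lemma card_verts_Gamma: "card (pverts \<Gamma>) = n * (m + t)"
  unfolding verts_Gamma by (subst card_Un_disjoint) (auto simp: card_image algebra_simps)

lemma neighbours_V:
  assumes "i < n" "j < m"
  shows "parcs \<Gamma> `` {Inl (i, j)} = Inl ` (R1 `` {i} \<times> R4 `` {j}) \<union> Inr ` ({i} \<times> {..<t})"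
  using assms regular_relD(2)[OF R1] regular_relD(2)[OF R4]
  by (auto simp: \<Gamma>_def Gamma_graph_def Let_def edges1_def edges2_def edges3_def diagonal_orbital_def sym_def)

lemma neighbours_U:
  assumes "i < n" "j < t"
  shows "parcs \<Gamma> `` {Inr (i, j)} = Inr ` (R2 `` {i} \<times> R5 `` {j}) \<union> Inl ` ({i} \<times> {..<m})"
  using assms regular_relD(2)[OF R2] regular_relD(2)[OF R5]
  by (auto simp: \<Gamma>_def Gamma_graph_def Let_def edges1_def edges2_def edges3_def diagonal_orbital_def sym_def)

lemma parcs_Gamma_subset: "parcs \<Gamma> \<subseteq> pverts \<Gamma> \<times> pverts \<Gamma>"
  using regular_relD(1)[OF R1] regular_relD(1)[OF R2] regular_relD(1)[OF R4] regular_relD(1)[OF R5]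
  unfolding \<Gamma>_def
  by (auto simp: Gamma_graph_def Let_def edges1_def edges2_def edges3_def diagonal_orbital_def
      V_part_def U_part_def)

lemma pair_fin_digraph_Gamma: "pair_fin_digraph \<Gamma>"
proof -
  have "finite (pverts \<Gamma>)" by (simp add: verts_Gamma)
  thus ?thesis
    using parcs_Gamma_subset finite_subset[OF parcs_Gamma_subset] by unfold_locales auto
qed

lemma pair_graph_Gamma:
  assumes "\<And>i j. (i, i) \<in> R1 \<Longrightarrow> (j, j) \<in> R4 \<Longrightarrow> False"
    and "\<And>i j. (i, i) \<in> R2 \<Longrightarrow> (j, j) \<in> R5 \<Longrightarrow> False"
  shows "pair_graph \<Gamma>"
proof -
  interpret pair_fin_digraph \<Gamma> by (rule pair_fin_digraph_Gamma)
  have "symmetric (with_proj \<Gamma>)"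
    by (auto simp: symmetric_def \<Gamma>_def Gamma_graph_def Let_def sym_Un_converse)
  moreover have "(v, v) \<notin> parcs \<Gamma>" for v
    using assms
    by (auto simp: \<Gamma>_def Gamma_graph_def Let_def edges1_def edges2_def edges3_def)
  ultimately show ?thesis by unfold_locales auto
qed

lemma nbr_sum_V:
  assumes "i < n" "j < m"
  shows "nbr_sum (parcs \<Gamma>) f (Inl (i, j))
    = nbr_sum R1 (\<lambda>i'. nbr_sum R4 (\<lambda>j'. f (Inl (i', j'))) j) i + (\<Sum>j'<t. f (Inr (i, j')))"
  unfolding nbr_sum_def neighbours_V[OF assms]
  using regular_relD(6)[OF R1] regular_relD(6)[OF R4]
  by (subst sum.union_disjoint) (auto simp: sum_image_Times)

lemma nbr_sum_U:
  assumes "i < n" "j < t"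
  shows "nbr_sum (parcs \<Gamma>) f (Inr (i, j))
    = nbr_sum R2 (\<lambda>i'. nbr_sum R5 (\<lambda>j'. f (Inr (i', j'))) j) i + (\<Sum>j'<m. f (Inl (i, j')))"
  unfolding nbr_sum_def neighbours_U[OF assms]
  using regular_relD(6)[OF R2] regular_relD(6)[OF R5]
  by (subst sum.union_disjoint) (auto simp: sum_image_Times)

lemma null_fun_Gamma_iff:
  "null_fun \<Gamma> f \<longleftrightarrow>
    (\<forall>i<n. \<forall>j<m. nbr_sum R1 (\<lambda>i'. nbr_sum R4 (\<lambda>j'. f (Inl (i', j'))) j) i + (\<Sum>j'<t. f (Inr (i, j'))) = 0) \<and>
    (\<forall>i<n. \<forall>j<t. nbr_sum R2 (\<lambda>i'. nbr_sum R5 (\<lambda>j'. f (Inr (i', j'))) j) i + (\<Sum>j'<m. f (Inl (i, j'))) = 0)"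
  unfolding null_fun_def ball_verts_Gamma by (simp add: nbr_sum_V nbr_sum_U)

definition lift :: "(nat \<Rightarrow> real) \<Rightarrow> (nat \<Rightarrow> real) \<Rightarrow> gvertex \<Rightarrow> real" where
  "lift \<xi> \<eta> = case_sum (\<xi> \<circ> fst) (\<eta> \<circ> fst)"

text \<open>The null equations for fibre-constant functions: a fibre of \<open>V\<close> has \<open>m\<close> points and one of \<open>U\<close> has
\<open>t\<close>, and a point sees \<open>a4\<close> (or \<open>a5\<close>) points of each fibre adjacent to its own in the same part.\<close>

definition quotient_null :: "(nat \<Rightarrow> real) \<Rightarrow> (nat \<Rightarrow> real) \<Rightarrow> bool" where
  "quotient_null \<xi> \<eta> \<longleftrightarrow>
    (\<forall>i<n. real a4 * nbr_sum R1 \<xi> i + real t * \<eta> i = 0 \<and> real a5 * nbr_sum R2 \<eta> i + real m * \<xi> i = 0)"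

lemma null_fun_lift_iff: "null_fun \<Gamma> (lift \<xi> \<eta>) \<longleftrightarrow> quotient_null \<xi> \<eta>"
proof -
  have "null_fun \<Gamma> (lift \<xi> \<eta>) \<longleftrightarrow>
    (\<forall>i<n. \<forall>j<m. real a4 * nbr_sum R1 \<xi> i + real t * \<eta> i = 0) \<and>
    (\<forall>i<n. \<forall>j<t. real a5 * nbr_sum R2 \<eta> i + real m * \<xi> i = 0)"
    unfolding null_fun_Gamma_iff by (simp add: lift_def nbr_sum_const[OF R4] nbr_sum_const[OF R5] nbr_sum_scale)
  thus ?thesis using pos(2,3) unfolding quotient_null_def by blast
qed

lemma null_fun_cong:
  assumes "\<And>v. v \<in> pverts \<Gamma> \<Longrightarrow> f v = g v"
  shows "null_fun \<Gamma> f \<longleftrightarrow> null_fun \<Gamma> g"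
proof -
  have "nbr_sum (parcs \<Gamma>) f v = nbr_sum (parcs \<Gamma>) g v" for v
    unfolding nbr_sum_def using parcs_Gamma_subset assms by (intro sum.cong) auto
  thus ?thesis by (simp add: null_fun_def)
qed

lemma null_fun_is_lift:
  assumes n1: "\<not> singular_graph (orbital_graph n R1)" and n2: "\<not> singular_graph (orbital_graph n R2)"
    and n4: "\<not> singular_graph (orbital_graph m R4)" and n5: "\<not> singular_graph (orbital_graph t R5)"
    and f: "null_fun \<Gamma> f"
  obtains \<xi> \<eta> where "quotient_null \<xi> \<eta>" "\<forall>v\<in>pverts \<Gamma>. f v = lift \<xi> \<eta> v"
proof
  define \<xi> where "\<xi> i = f (Inl (i, 0))" for i
  define \<eta> where "\<eta> i = f (Inr (i, 0))" for i
  have V: "f (Inl (i, j)) = \<xi> i" if "i < n" "j < m" for i j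
    unfolding \<xi>_def
  proof (rule fibre_constant[OF R1 R4 _ n1 n4])
    fix i j assume "i < n" "j < m"
    thus "nbr_sum R1 (\<lambda>i'. nbr_sum R4 (\<lambda>j'. f (Inl (i', j'))) j) i = - (\<Sum>j'<t. f (Inr (i, j')))"
      using f unfolding null_fun_Gamma_iff by (auto simp: add_eq_0_iff2)
  qed (use that pos in auto)
  have U: "f (Inr (i, j)) = \<eta> i" if "i < n" "j < t" for i j
    unfolding \<eta>_def
  proof (rule fibre_constant[OF R2 R5 _ n2 n5])
    fix i j assume "i < n" "j < t"
    thus "nbr_sum R2 (\<lambda>i'. nbr_sum R5 (\<lambda>j'. f (Inr (i', j'))) j) i = - (\<Sum>j'<m. f (Inl (i, j')))"
      using f unfolding null_fun_Gamma_iff by (auto simp: add_eq_0_iff2)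
  qed (use that pos in auto)
  show eq: "\<forall>v\<in>pverts \<Gamma>. f v = lift \<xi> \<eta> v"
    using V U by (auto simp: verts_Gamma lift_def)
  show "quotient_null \<xi> \<eta>"
    unfolding null_fun_lift_iff[symmetric] by (rule iffD1[OF null_fun_cong[OF eq[rule_format]] f])
qed

text \<open>The kernel condition of nut graphs, for this system in place of an adjacency matrix.\<close>

definition quotient_nut :: bool where
  "quotient_nut \<longleftrightarrow> (\<exists>\<xi> \<eta>. quotient_null \<xi> \<eta> \<and> (\<forall>i<n. \<xi> i \<noteq> 0 \<and> \<eta> i \<noteq> 0) \<and>
     (\<forall>\<xi>' \<eta>'. quotient_null \<xi>' \<eta>' \<longrightarrow> (\<exists>c. \<forall>i<n. \<xi>' i = c * \<xi> i \<and> \<eta>' i = c * \<eta> i)))"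

lemma ball_lift:
  "(\<forall>v\<in>pverts \<Gamma>. P (lift \<xi> \<eta> v) (lift \<xi>' \<eta>' v)) \<longleftrightarrow> (\<forall>i<n. P (\<xi> i) (\<xi>' i) \<and> P (\<eta> i) (\<eta>' i))"
  unfolding ball_verts_Gamma using pos(2,3) by (auto simp: lift_def)

text \<open>By \<open>fibre_constant\<close> every null function of the graph is the lift of a solution. As fibres are
nonempty, lifting preserves and reflects both the absence of zeros and being a multiple.\<close>

lemma nut_graph_iff_quotient_nut:
  assumes n1: "\<not> singular_graph (orbital_graph n R1)" and n2: "\<not> singular_graph (orbital_graph n R2)"
    and n4: "\<not> singular_graph (orbital_graph m R4)" and n5: "\<not> singular_graph (orbital_graph t R5)"
    and simple: "pair_graph \<Gamma>"
  shows "nut_graph \<Gamma> \<longleftrightarrow> quotient_nut"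
proof -
  have ne: "pverts \<Gamma> \<noteq> {}" using pos by (auto simp: verts_Gamma)
  note lift = null_fun_is_lift[OF n1 n2 n4 n5]
  have multiple: "(\<forall>v\<in>pverts \<Gamma>. lift \<xi>' \<eta>' v = c * lift \<xi> \<eta> v) \<longleftrightarrow>
      (\<forall>i<n. \<xi>' i = c * \<xi> i \<and> \<eta>' i = c * \<eta> i)" for \<xi> \<eta> \<xi>' \<eta>' c
    by (rule ball_lift)
  have full: "(\<forall>v\<in>pverts \<Gamma>. lift \<xi> \<eta> v \<noteq> 0) \<longleftrightarrow> (\<forall>i<n. \<xi> i \<noteq> 0 \<and> \<eta> i \<noteq> 0)" for \<xi> \<eta>
    by (rule ball_lift[where P = "\<lambda>x _. x \<noteq> 0"])
  show ?thesis
    unfolding nut_graph_iff[OF pair_fin_digraph_Gamma ne]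
  proof
    assume "pair_graph \<Gamma> \<and>
    (\<exists>f. null_fun \<Gamma> f \<and> (\<forall>v\<in>pverts \<Gamma>. f v \<noteq> 0) \<and>
         (\<forall>g. null_fun \<Gamma> g \<longrightarrow> (\<exists>c. \<forall>v\<in>pverts \<Gamma>. g v = c * f v)))"
    then obtain f where f: "null_fun \<Gamma> f" "\<forall>v\<in>pverts \<Gamma>. f v \<noteq> 0"
      "\<And>g. null_fun \<Gamma> g \<Longrightarrow> \<exists>c. \<forall>v\<in>pverts \<Gamma>. g v = c * f v" by blast
    obtain \<xi> \<eta> where q: "quotient_null \<xi> \<eta>" "\<forall>v\<in>pverts \<Gamma>. f v = lift \<xi> \<eta> v"
      by (rule lift[OF f(1)])
    have "\<exists>c. \<forall>i<n. \<xi>' i = c * \<xi> i \<and> \<eta>' i = c * \<eta> i" if "quotient_null \<xi>' \<eta>'" for \<xi>' \<eta>'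
      using f(3)[of "lift \<xi>' \<eta>'"] that q(2) multiple[of \<xi>' \<eta>' _ \<xi> \<eta>] by (simp add: null_fun_lift_iff)
    moreover have "\<forall>i<n. \<xi> i \<noteq> 0 \<and> \<eta> i \<noteq> 0" using f(2) q(2) full[of \<xi> \<eta>] by simp
    ultimately show quotient_nut unfolding quotient_nut_def using q(1) by blast
  next
    assume quotient_nut
    then obtain \<xi> \<eta> where q: "quotient_null \<xi> \<eta>" "\<forall>i<n. \<xi> i \<noteq> 0 \<and> \<eta> i \<noteq> 0"
      "\<And>\<xi>' \<eta>'. quotient_null \<xi>' \<eta>' \<Longrightarrow> \<exists>c. \<forall>i<n. \<xi>' i = c * \<xi> i \<and> \<eta>' i = c * \<eta> i"
      unfolding quotient_nut_def by blast
    have "\<exists>c. \<forall>v\<in>pverts \<Gamma>. g v = c * lift \<xi> \<eta> v" if g: "null_fun \<Gamma> g" for g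
    proof -
      obtain \<xi>' \<eta>' where q': "quotient_null \<xi>' \<eta>'" "\<forall>v\<in>pverts \<Gamma>. g v = lift \<xi>' \<eta>' v"
        by (rule lift[OF g])
      from q(3)[OF q'(1)] obtain c where "\<forall>v\<in>pverts \<Gamma>. lift \<xi>' \<eta>' v = c * lift \<xi> \<eta> v"
        unfolding multiple by blast
      thus ?thesis using q'(2) by auto
    qed
    thus "pair_graph \<Gamma> \<and>
    (\<exists>f. null_fun \<Gamma> f \<and> (\<forall>v\<in>pverts \<Gamma>. f v \<noteq> 0) \<and>
         (\<forall>g. null_fun \<Gamma> g \<longrightarrow> (\<exists>c. \<forall>v\<in>pverts \<Gamma>. g v = c * f v)))"
      using simple q(1,2) full[of \<xi> \<eta>] null_fun_lift_iff by blast
  qed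
qed

end

section \<open>The valence condition\<close>

lemma out_degree_induce_subgraph:
  assumes "v \<in> W"
  shows "out_degree (induce_subgraph (with_proj G) W) v = card (parcs G `` {v} \<inter> W)"
proof -
  have "out_arcs (induce_subgraph (with_proj G) W) v = Pair v ` (parcs G `` {v} \<inter> W)"
    using assms by (auto simp: out_arcs_def induce_subgraph_def)
  thus ?thesis by (simp add: out_degree_def card_image inj_on_def)
qed

lemma neighbors_in_eq: "neighbors_in G W v = parcs G `` {v} \<inter> W"
  by (auto simp: neighbors_in_def)

context fibred_graph
begin

lemma valence_condition_iff:
  "valence_condition \<Gamma> (V_part n m) (U_part n t) \<longleftrightarrow> a1 * a4 * (a2 * a5) = t * m"
proof -
  have V: "V_part n m = Inl ` ({..<n} \<times> {..<m})" by (auto simp: V_part_def)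
  have U: "U_part n t = Inr ` ({..<n} \<times> {..<t})" by (auto simp: U_part_def)
  have VV: "card (parcs \<Gamma> `` {v} \<inter> V_part n m) = a1 * a4" if vin: "v \<in> V_part n m" for v
  proof -
    obtain i j where v: "v = Inl (i, j)" and ij: "i < n" "j < m"
      using vin by (auto simp: V)
    have "parcs \<Gamma> `` {Inl (i, j)} \<inter> V_part n m = Inl ` (R1 `` {i} \<times> R4 `` {j})"
      unfolding neighbours_V[OF ij] V
      using regular_relD(5)[OF R1, of i] regular_relD(5)[OF R4, of j] by blast
    thus ?thesis unfolding v using ij regular_relD(3)[OF R1] regular_relD(3)[OF R4]
      by (simp add: card_image card_cartesian_product)
  qed
  have VU: "card (parcs \<Gamma> `` {v} \<inter> U_part n t) = t" if vin: "v \<in> V_part n m" for v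
  proof -
    obtain i j where v: "v = Inl (i, j)" and ij: "i < n" "j < m"
      using vin by (auto simp: V)
    have "parcs \<Gamma> `` {Inl (i, j)} \<inter> U_part n t = Inr ` ({i} \<times> {..<t})"
      unfolding neighbours_V[OF ij] U using ij by blast
    thus ?thesis unfolding v by (simp add: card_image card_cartesian_product)
  qed
  have UU: "card (parcs \<Gamma> `` {v} \<inter> U_part n t) = a2 * a5" if vin: "v \<in> U_part n t" for v
  proof -
    obtain i j where v: "v = Inr (i, j)" and ij: "i < n" "j < t"
      using vin by (auto simp: U)
    have "parcs \<Gamma> `` {Inr (i, j)} \<inter> U_part n t = Inr ` (R2 `` {i} \<times> R5 `` {j})"
      unfolding neighbours_U[OF ij] U
      using regular_relD(5)[OF R2, of i] regular_relD(5)[OF R5, of j] by blast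
    thus ?thesis unfolding v using ij regular_relD(3)[OF R2] regular_relD(3)[OF R5]
      by (simp add: card_image card_cartesian_product)
  qed
  have UV: "card (parcs \<Gamma> `` {v} \<inter> V_part n m) = m" if vin: "v \<in> U_part n t" for v
  proof -
    obtain i j where v: "v = Inr (i, j)" and ij: "i < n" "j < t"
      using vin by (auto simp: U)
    have "parcs \<Gamma> `` {Inr (i, j)} \<inter> V_part n m = Inl ` ({i} \<times> {..<m})"
      unfolding neighbours_U[OF ij] V using ij by blast
    thus ?thesis unfolding v by (simp add: card_image card_cartesian_product)
  qed
  have ex: "(\<exists>v. v \<in> V_part n m)" "(\<exists>u. u \<in> U_part n t)" using pos by (auto simp: V U)
  have k1: "regular_of_valence (induce_subgraph (with_proj \<Gamma>) (V_part n m)) k \<longleftrightarrow> k = a1 * a4" for k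
    using ex(1) by (auto simp: regular_of_valence_def out_degree_induce_subgraph VV)
  have k2: "regular_of_valence (induce_subgraph (with_proj \<Gamma>) (U_part n t)) k \<longleftrightarrow> k = a2 * a5" for k
    using ex(2) by (auto simp: regular_of_valence_def out_degree_induce_subgraph UU)
  have d1: "(\<forall>v\<in>V_part n m. card (neighbors_in \<Gamma> (U_part n t) v) = d) \<longleftrightarrow> d = t" for d
    using ex(1) by (auto simp: neighbors_in_eq VU)
  have d2: "(\<forall>u\<in>U_part n t. card (neighbors_in \<Gamma> (V_part n m) u) = d) \<longleftrightarrow> d = m" for d
    using ex(2) by (auto simp: neighbors_in_eq UV)
  show ?thesis unfolding valence_condition_def k1 k2 d1 d2 by blast
qed

section \<open>Non-singularity of the fibre graphs of a nut graph\<close>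

text \<open>All null functions are multiples of one without zeros.\<close>

lemma nut_graph_null_fun_zero:
  assumes "nut_graph \<Gamma>" and "null_fun \<Gamma> g"
    and "u \<in> pverts \<Gamma>" "g u = 0" and "v \<in> pverts \<Gamma>"
  shows "g v = 0"
proof -
  have "pverts \<Gamma> \<noteq> {}" using assms(3) by auto
  then obtain f where "\<forall>v\<in>pverts \<Gamma>. f v \<noteq> 0"
    "\<And>g. null_fun \<Gamma> g \<Longrightarrow> \<exists>c. \<forall>v\<in>pverts \<Gamma>. g v = c * f v"
    using assms(1) nut_graph_iff[OF pair_fin_digraph_Gamma] by blast
  with assms(2-5) show ?thesis by (metis mult_eq_0_iff)
qed

text \<open>Let \<open>w\<close> be a null function of \<open>R4\<close>. A copy of \<open>w\<close> in every fibre of \<open>V\<close>, extended by zero, is a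
null function of the whole graph: at vertices of \<open>V\<close> because \<open>w\<close> is null, and at vertices of \<open>U\<close>
because the sum of \<open>w\<close> is zero. It vanishes on \<open>U\<close>.\<close>

lemma nut_graph_imp_nonsingular_R4:
  assumes "nut_graph \<Gamma>"
  shows "\<not> singular_graph (orbital_graph m R4)"
  unfolding nonsingular_orbital_graph_iff[OF regular_relD(1)[OF R4]]
proof (intro allI impI)
  fix w j assume w: "\<forall>j<m. nbr_sum R4 w j = 0" and "j < m"
  have "(\<Sum>j<m. w j) = 0" using sum_null_eq_0[OF R4 pos(6)] w by blast
  hence "null_fun \<Gamma> (case_sum (w \<circ> snd) (\<lambda>_. 0))"
    using w unfolding null_fun_Gamma_iff by (simp add: nbr_sum_const[OF R1] nbr_sum_const[OF R2] nbr_sum_const[OF R5])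
  from nut_graph_null_fun_zero[OF assms this, of "Inr (0, 0)" "Inl (0, j)"]
  show "w j = 0" using pos \<open>j < m\<close> by (auto simp: verts_Gamma)
qed

lemma nut_graph_imp_nonsingular_R5:
  assumes "nut_graph \<Gamma>"
  shows "\<not> singular_graph (orbital_graph t R5)"
  unfolding nonsingular_orbital_graph_iff[OF regular_relD(1)[OF R5]]
proof (intro allI impI)
  fix w j assume w: "\<forall>j<t. nbr_sum R5 w j = 0" and "j < t"
  have "(\<Sum>j<t. w j) = 0" using sum_null_eq_0[OF R5 pos(7)] w by blast
  hence "null_fun \<Gamma> (case_sum (\<lambda>_. 0) (w \<circ> snd))"
    using w unfolding null_fun_Gamma_iff by (simp add: nbr_sum_const[OF R1] nbr_sum_const[OF R2] nbr_sum_const[OF R4])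
  from nut_graph_null_fun_zero[OF assms this, of "Inl (0, 0)" "Inr (0, j)"]
  show "w j = 0" using pos \<open>j < t\<close> by (auto simp: verts_Gamma)
qed

section \<open>The quotient system\<close>

text \<open>Common automorphisms of \<open>R1\<close> and \<open>R2\<close> permute the solutions, so they act on the line of solutions by
scalars \<open>c\<close>; preserving the sum of squares, these are \<open>1\<close> or \<open>-1\<close>. Hence \<open>\<bar>\<eta>\<bar>\<close> is constant
and the odd number of its values cannot add up to zero.\<close>

lemma quotient_nut_imp_valence:
  assumes nut: quotient_nut and "odd n"
    and trans: "\<And>i. i < n \<Longrightarrow> \<exists>g. rel_automorphism n R1 g \<and> rel_automorphism n R2 g \<and> g 0 = i"
  shows "a1 * a4 * (a2 * a5) = t * m"
proof -
  obtain \<xi> \<eta> where q: "quotient_null \<xi> \<eta>" "\<forall>i<n. \<xi> i \<noteq> 0 \<and> \<eta> i \<noteq> 0"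
    "\<And>\<xi>' \<eta>'. quotient_null \<xi>' \<eta>' \<Longrightarrow> \<exists>c. \<forall>i<n. \<xi>' i = c * \<xi> i \<and> \<eta>' i = c * \<eta> i"
    using nut unfolding quotient_nut_def by blast
  have abs: "\<bar>\<eta> i\<bar> = \<bar>\<eta> 0\<bar>" if "i < n" for i
  proof -
    obtain g where g: "rel_automorphism n R1 g" "rel_automorphism n R2 g" "g 0 = i"
      using trans[OF \<open>i < n\<close>] by blast
    have bij: "bij_betw g {..<n} {..<n}" using g(1) by (simp add: rel_automorphism_def)
    have "quotient_null (\<lambda>i. \<xi> (g i)) (\<lambda>i. \<eta> (g i))"
      using q(1) bij_betw_apply[OF bij] unfolding quotient_null_def
      by (simp add: nbr_sum_automorphism[OF R1 g(1)] nbr_sum_automorphism[OF R2 g(2)])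
    then obtain c where c: "\<And>i. i < n \<Longrightarrow> \<eta> (g i) = c * \<eta> i" using q(3) by blast
    have "(\<Sum>i<n. (\<eta> i)\<^sup>2) = (\<Sum>i<n. (\<eta> (g i))\<^sup>2)"
      by (rule sum.reindex_bij_betw[OF bij, symmetric])
    also have "\<dots> = c\<^sup>2 * (\<Sum>i<n. (\<eta> i)\<^sup>2)"
      by (simp add: c power_mult_distrib sum_distrib_left)
    finally have "(\<Sum>i<n. (\<eta> i)\<^sup>2) = c\<^sup>2 * (\<Sum>i<n. (\<eta> i)\<^sup>2)" .
    moreover have "(\<Sum>i<n. (\<eta> i)\<^sup>2) > 0"
      using q(2) pos(1) by (intro sum_pos) auto
    ultimately have "c\<^sup>2 = 1" by simp
    hence "\<bar>c\<bar> = 1" by (auto simp: power2_eq_1_iff)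
    thus ?thesis using c[of 0] g(3) pos(1) by (simp add: abs_mult)
  qed
  define X where "X = (\<Sum>i<n. \<xi> i)"
  define Y where "Y = (\<Sum>i<n. \<eta> i)"
  have "Y \<noteq> 0" unfolding Y_def
    using abs by (rule odd_sum_of_signs_nonzero[OF \<open>odd n\<close>]) (use q(2) pos(1) in auto)
  \<comment> \<open>Summing the equations over \<open>i\<close> replaces \<open>R1\<close> and \<open>R2\<close> by their valences.\<close>
  have "(\<Sum>i<n. real a4 * nbr_sum R1 \<xi> i + real t * \<eta> i) = 0"
    using q(1) by (simp add: quotient_null_def)
  hence 1: "real a4 * (real a1 * X) + real t * Y = 0"
    by (simp add: sum.distrib sum_distrib_left[symmetric] sum_nbr_sum[OF R1] X_def Y_def)
  have "(\<Sum>i<n. real a5 * nbr_sum R2 \<eta> i + real m * \<xi> i) = 0"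
    using q(1) by (simp add: quotient_null_def)
  hence 2: "real a5 * (real a2 * Y) + real m * X = 0"
    by (simp add: sum.distrib sum_distrib_left[symmetric] sum_nbr_sum[OF R2] X_def Y_def)
  have "real a1 * real a4 * (real a2 * real a5) * Y = real t * real m * Y"
  proof -
    have "real a1 * real a4 * (real a2 * real a5) * Y = real a1 * real a4 * (real a5 * (real a2 * Y))"
      by simp
    also have "real a5 * (real a2 * Y) = - (real m * X)" using 2 by linarith
    also have "real a1 * real a4 * - (real m * X) = - real m * (real a4 * (real a1 * X))" by simp
    also have "real a4 * (real a1 * X) = - (real t * Y)" using 1 by linarith
    finally show ?thesis by (simp add: mult_ac)
  qed
  hence "real (a1 * a4 * (a2 * a5)) = real (t * m)" using \<open>Y \<noteq> 0\<close> by simp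
  thus ?thesis by (simp only: of_nat_eq_iff)
qed

text \<open>A closed set of a symmetric relation is a union of components, and on each component the constants
\<open>- t\<close> and \<open>a1 a4\<close> solve the first equation; the valence condition is what the second one asks for.\<close>

lemma quotient_null_closed:
  assumes valence: "a1 * a4 * (a2 * a5) = t * m" and S: "(R1 \<union> R2) `` S \<subseteq> S"
  shows "quotient_null (\<lambda>i. if i \<in> S then - real t else 0) (\<lambda>i. if i \<in> S then real a1 * real a4 else 0)"
proof -
  have "real a5 * (real a2 * (real a1 * real a4)) = real m * real t"
    using arg_cong[OF valence, of real] by (simp add: mult_ac)
  moreover have "R1 `` S \<subseteq> S" "R2 `` S \<subseteq> S" using S by auto
  ultimately show ?thesis
    unfolding quotient_null_def by (simp add: nbr_sum_closed[OF R1] nbr_sum_closed[OF R2])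
qed

text \<open>The solution supported on a closed set is a nonzero multiple of a solution without zeros, so its
support is everything.\<close>

lemma quotient_nut_imp_connected:
  assumes nut: quotient_nut and valence: "a1 * a4 * (a2 * a5) = t * m"
  shows "closed_connected n (R1 \<union> R2)"
  unfolding closed_connected_def
proof (intro allI impI equalityI subsetI)
  fix S i assume S: "S \<subseteq> {..<n}" "S \<noteq> {}" "(R1 \<union> R2) `` S \<subseteq> S" and i: "i \<in> {..<n}"
  obtain \<xi> \<eta> where q: "\<forall>i<n. \<xi> i \<noteq> 0 \<and> \<eta> i \<noteq> 0"
    "\<And>\<xi>' \<eta>'. quotient_null \<xi>' \<eta>' \<Longrightarrow> \<exists>c. \<forall>i<n. \<xi>' i = c * \<xi> i \<and> \<eta>' i = c * \<eta> i"
    using nut unfolding quotient_nut_def by blast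
  obtain c where c: "\<And>i. i < n \<Longrightarrow> (if i \<in> S then - real t else 0) = c * \<xi> i"
    using q(2)[OF quotient_null_closed[OF valence S(3)]] by blast
  obtain k where k: "k \<in> S" "k < n" using S(1,2) by auto
  have "c \<noteq> 0" using c[OF k(2)] k(1) pos(3) by auto
  thus "i \<in> S" using c[of i] q(1) i by (auto split: if_splits)
qed auto

text \<open>The constant solution has no zeros. Any other one is constant as well, because a multiple of \<open>\<xi>\<close>
and \<open>\<eta>\<close> average each other, and the first equation fixes the ratio of the two constants.\<close>

lemma quotient_nutI:
  assumes valence: "a1 * a4 * (a2 * a5) = t * m" and conn: "closed_connected n (R1 \<union> R2)"
    and "odd n"
  shows quotient_nut
proof -
  let ?\<xi> = "\<lambda>i. if i \<in> {..<n} then - real t else 0"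
  let ?\<eta> = "\<lambda>i. if i \<in> {..<n} then real a1 * real a4 else 0"
  have sol: "quotient_null ?\<xi> ?\<eta>"
    using regular_relD(1)[OF R1] regular_relD(1)[OF R2]
    by (intro quotient_null_closed[OF valence]) auto
  have full: "\<forall>i<n. ?\<xi> i \<noteq> 0 \<and> ?\<eta> i \<noteq> 0" using pos by simp
  have line: "\<exists>c. \<forall>i<n. \<xi> i = c * ?\<xi> i \<and> \<eta> i = c * ?\<eta> i" if q: "quotient_null \<xi> \<eta>" for \<xi> \<eta>
  proof -
    \<comment> \<open>With this scaling the first equation says that \<open>\<eta>\<close> is the average of \<open>z \<xi>\<close> over
      \<open>R1\<close>-neighbours; by the valence condition, the second says that \<open>z \<xi>\<close> is the average
      of \<open>\<eta>\<close> over \<open>R2\<close>-neighbours.\<close>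
    define z where "z = - (real a1 * real a4 / real t)"
    have val: "real m = real a1 * real a4 * (real a2 * real a5) / real t"
      using arg_cong[OF valence, of real] pos(3) by (simp add: field_simps)
    have "\<exists>c. \<forall>i<n. \<eta> i = c \<and> z * \<xi> i = c"
    proof (rule constant_of_coupled_averages[OF R1 R2 pos(4,5) \<open>odd n\<close> conn])
      fix i assume "i < n"
      hence "real a4 * nbr_sum R1 \<xi> i = - (real t * \<eta> i)" "real a5 * nbr_sum R2 \<eta> i = - (real m * \<xi> i)"
        using q unfolding quotient_null_def by (simp_all add: eq_neg_iff_add_eq_0)
      hence A1: "nbr_sum R1 \<xi> i = - (real t * \<eta> i) / real a4"
        and A2: "nbr_sum R2 \<eta> i = - (real m * \<xi> i) / real a5"
        using pos by (simp_all add: field_simps)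
      show "nbr_sum R1 (\<lambda>i. z * \<xi> i) i = real a1 * \<eta> i"
        unfolding nbr_sum_scale A1 using pos by (simp add: z_def)
      show "nbr_sum R2 \<eta> i = real a2 * (z * \<xi> i)"
        unfolding A2 val using pos by (simp add: z_def)
    qed
    then obtain c where "\<forall>i<n. \<eta> i = c \<and> z * \<xi> i = c" by blast
    hence "\<forall>i<n. \<xi> i = c / (real a1 * real a4) * ?\<xi> i \<and> \<eta> i = c / (real a1 * real a4) * ?\<eta> i"
      using pos by (auto simp: z_def field_simps)
    thus ?thesis by blast
  qed
  show ?thesis
    unfolding quotient_nut_def
    by (rule exI[of _ ?\<xi>], rule exI[of _ ?\<eta>], intro conjI sol full, intro allI impI, rule line)
qed

end

section \<open>The characterisation of nut graphs\<close>

theorem theorem3p7: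
  fixes n m t :: nat
    and G H K :: "(nat \<Rightarrow> nat) set"
    and \<Delta>1 \<Delta>2 \<Delta>4 \<Delta>5 :: "nat rel"
    and \<Gamma> :: "gvertex pair_pre_digraph"
  assumes "n > 1" and "m \<ge> 1" and "t \<ge> 1"
    and "transitive_perm_group n G"
    and "transitive_perm_group m H"
    and "transitive_perm_group t K"
    and "\<Delta>1 \<in> orbitals n G" and "self_paired \<Delta>1"
    and "\<Delta>2 \<in> orbitals n G" and "self_paired \<Delta>2"
    and "\<Delta>4 \<in> orbitals m H" and "self_paired \<Delta>4"
    and "\<Delta>1 = diagonal_orbital n \<Longrightarrow> \<Delta>4 \<noteq> diagonal_orbital m"
    and "\<Delta>5 \<in> orbitals t K" and "self_paired \<Delta>5"
    and "\<Delta>2 = diagonal_orbital n \<Longrightarrow> \<Delta>5 \<noteq> diagonal_orbital t"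
    and "\<Gamma> = Gamma_graph n m t \<Delta>1 \<Delta>2 (diagonal_orbital n) \<Delta>4 \<Delta>5"
    and "odd (card (pverts \<Gamma>))"
    and "\<not> singular_graph (orbital_graph n \<Delta>1)"
    and "\<not> singular_graph (orbital_graph n \<Delta>2)"
  shows "nut_graph \<Gamma> \<longleftrightarrow>
           \<not> singular_graph (orbital_graph m \<Delta>4) \<and>
           \<not> singular_graph (orbital_graph t \<Delta>5) \<and>
           Digraph_Component.connected (with_proj (orbital_graph n (\<Delta>1 \<union> \<Delta>2))) \<and>
           valence_condition \<Gamma> (V_part n m) (U_part n t)"
proof -
  obtain a1 a2 a4 a5 where reg:
    "a1 > 0" "regular_rel n \<Delta>1 a1" "a2 > 0" "regular_rel n \<Delta>2 a2"
    "a4 > 0" "regular_rel m \<Delta>4 a4" "a5 > 0" "regular_rel t \<Delta>5 a5"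
    using orbital_regular[OF assms(4,7,8)] orbital_regular[OF assms(4,9,10)]
      orbital_regular[OF assms(5,11,12)] orbital_regular[OF assms(6,14,15)] by blast
  interpret fg: fibred_graph n m t \<Delta>1 \<Delta>2 \<Delta>4 \<Delta>5 a1 a2 a4 a5
    using reg assms(1-3) by unfold_locales auto
  have \<Gamma>: "\<Gamma> = fg.\<Gamma>" using assms(17) by (simp add: fg.\<Gamma>_def)
  have "odd n" using assms(18) by (simp add: \<Gamma> fg.card_verts_Gamma)
  have simple: "pair_graph fg.\<Gamma>"
    using orbital_diagonal[OF assms(4,7)] orbital_diagonal[OF assms(4,9)]
      orbital_diagonal[OF assms(5,11)] orbital_diagonal[OF assms(6,14)] assms(13,16)
    by (intro fg.pair_graph_Gamma) blast+
  have aut: "\<exists>g. rel_automorphism n \<Delta>1 g \<and> rel_automorphism n \<Delta>2 g \<and> g 0 = i" if "i < n" for i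
    using transitive_perm_groupD(3)[OF assms(4), of 0 i] that fg.pos(1)
      orbital_automorphism[OF assms(4,7)] orbital_automorphism[OF assms(4,9)] by blast
  have "Digraph_Component.connected (with_proj (orbital_graph n (\<Delta>1 \<union> \<Delta>2)))
      \<longleftrightarrow> closed_connected n (\<Delta>1 \<union> \<Delta>2)"
    using regular_relD(1,2)[OF reg(2)] regular_relD(1,2)[OF reg(4)] fg.pos(1)
    by (intro connected_orbital_graph_iff) (auto simp: sym_Un)
  thus ?thesis
    unfolding \<Gamma> fg.valence_condition_iff
    using fg.nut_graph_imp_nonsingular_R4 fg.nut_graph_imp_nonsingular_R5
      fg.nut_graph_iff_quotient_nut[OF assms(19,20) _ _ simple]
      fg.quotient_nut_imp_valence[OF _ \<open>odd n\<close> aut] fg.quotient_nut_imp_connected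
      fg.quotient_nutI[OF _ _ \<open>odd n\<close>]
    by blast
qed

end
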